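(* Let $\mathcal{H}$ be a real Hilbert space, $T:\mathcal{H}\rightrightarrows\mathcal{H}$ a set-valued operator, $c:\mathcal{H}\to\mathbb{R}$ a function and $C=\{x\in\mathcal{H}: c(x)\le 0\}$, and suppose that Assumptions (A1)--(A4) of the context hold. Let $x^0\in\mathcal{H}$ and let $(x^k)_{k\ge0}$ be generated by the algorithm FSPA described in the context. Let $\bar x=P_{S^*}(x^0)$ and $\rho=\|x^0-\bar x\|$. Let $M_c>0$ be a bound for the subgradients of $c$ at the iterates with $c(x^k)>0$ (i.e. $\|g\|\le M_c$ for all $k$ with $c(x^k)>0$ and all $g\in\partial c(x^k)$), and let $M_T:=\sup_k\|v^k\|$, which is finite. Write $c_+(x)=\max\{c(x),0\}$. Then, for every integer $N\ge 1$, $$\min_{0\le i<N}\|x^{i+1}-x^i\|\le\frac{\rho}{\sqrt N},\qquad \min_{0\le i<N}c_+(x^i)\le\frac{M_c\,\rho}{\sqrt N},$$ $$\min_{0\le i<N}\Phi_+(x^i)\le\frac{M_T\,\rho}{\sigma\sqrt N}+\frac1\sigma\max_{0\le i<N}\varepsilon_i .$$ In particular, if $\varepsilon_i=0$ for all $i$, then $\min_{0\le i<N}\Phi_+(x^i)\le\frac{M_T\,\rho}{\sigma\sqrt N}$. Moreover, for all integers $0\le m<N$, $$\min_{m\le i<N}\Phi_+(x^i)\le\frac{M_T}{\sigma}\left(\frac{\rho^2-\|x^m-x^0\|^2}{N-m}\right)^{1/2}+\frac1\sigma\max_{m\le i<N}\varepsilon_i .$$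
   Context: $\mathcal{H}$ is a real Hilbert space with inner product $\langle\cdot,\cdot\rangle$ and norm $\|\cdot\|$. For a nonempty closed convex set $S$, $P_S$ is the metric projection onto $S$. For $T:\mathcal{H}\rightrightarrows\mathcal{H}$, $\operatorname{Gph}(T)=\{(x,u):u\in T(x)\}$ and $\operatorname{dom}T=\{x:T(x)\ne\emptyset\}$. $\partial c$ is the convex subdifferential of $c$. $[t]_+=\max\{t,0\}$. Feasible set: $C=\{x\in\mathcal{H}:c(x)\le 0\}$. Solution set: $S^*$ is the set of $x^*\in C$ for which there is $u^*\in T(x^* )$ with $\langle u^*,x-x^*\rangle\ge 0$ for all $x\in C$. Normal cone: $N_C(x)=\{n:\langle n,z-x\rangle\le 0\ \forall z\in C\}$ if $x\in C$, and $N_C(x)=\emptyset$ otherwise. Minty gap: $\Phi(x)=\sup\{\langle w,x-z\rangle: z\in C,\ w\in T(z)\}\in(-\infty,+\infty]$ and $\Phi_+(x)=\max\{\Phi(x),0\}$. Assumptions. (A1) $c$ is convex and continuous, $C\neq\emptyset$, and for every bounded $B\subset\mathcal{H}$ there is $M_B>0$ with $\|g\|\le M_B$ for all $x\in B$ with $c(x)>0$ and all $g\in\partial c(x)$; moreover $\partial c(x)\ne\emptyset$ whenever $c(x)>0$. (A2) A fixed point $s\in\mathcal{H}$ with $c(s)<0$ is given (Slater point). (A3) $T$ is maximal monotone, $C\subseteq\operatorname{dom}T$, $S^*\neq\emptyset$, and $T+N_C$ is maximal monotone. (A4) There are $\sigma\in(0,1]$, a sequence $\varepsilon_k\ge 0$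 with $\varepsilon_k\to 0$, and an oracle which for every $x^k$ returns a trial point $\widetilde y^k\in\mathcal{H}$. One sets $\lambda_k=0$ if $c(\widetilde y^k)\le 0$ and $\lambda_k=\frac{c(\widetilde y^k)}{c(\widetilde y^k)-c(s)}$ if $c(\widetilde y^k)>0$, and $y^k=(1-\lambda_k)\widetilde y^k+\lambda_k s$; the oracle then chooses $v^k\in T(y^k)$. Whenever $(x^k)$ is bounded, the sequences $(y^k)$ and $(v^k)$ are bounded and $[\langle v^k,x^k-y^k\rangle]_+\ge\sigma\Phi_+(x^k)-\varepsilon_k$ for all $k$. Algorithm FSPA. Start from $x^0\in\mathcal{H}$. For $k=0,1,2,\dots$: 1. If $c(x^k)>0$, choose $g^k\in\partial c(x^k)$ and set $C_k=\{x: c(x^k)+\langle g^k,x-x^k\rangle\le 0\}$; otherwise set $C_k=\mathcal{H}$. 2. Obtain $\widetilde y^k$, $\lambda_k$, $y^k$, $v^k\in T(y^k)$ from the oracle as in (A4), and set $H_k=\{x:\langle v^k,x-y^k\rangle\le 0\}$. 3. Set $W_k=\{x:\langle x-x^k,x^0-x^k\rangle\le 0\}$. 4. Set $x^{k+1}=P_{C_k\cap H_k\cap W_k}(x^0)$. *)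

theory Defs
  imports "HOL-Analysis.Analysis" "HOL-Library.Set_Algebras"
begin

text \<open>
  A set-valued operator on \<open>'a\<close> is a function \<open>'a \<Rightarrow> 'a set\<close>; its value is empty outside the domain.
  Hilbert spaces are types of sort \<open>{real_inner, complete_space}\<close>.
\<close>

definition op_graph :: "('a \<Rightarrow> 'a set) \<Rightarrow> ('a \<times> 'a) set"
  where "op_graph T = {(x, u). u \<in> T x}"

definition op_dom :: "('a \<Rightarrow> 'a set) \<Rightarrow> 'a set"
  where "op_dom T = {x. T x \<noteq> {}}"

definition monotone_operator :: "('a::real_inner \<Rightarrow> 'a set) \<Rightarrow> bool"
  where "monotone_operator T \<longleftrightarrow>
    (\<forall>(x, u)\<in>op_graph T. \<forall>(y, w)\<in>op_graph T. inner (u - w) (x - y) \<ge> 0)"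

definition maximal_monotone :: "('a::real_inner \<Rightarrow> 'a set) \<Rightarrow> bool"
  where "maximal_monotone T \<longleftrightarrow> monotone_operator T \<and>
    (\<forall>T'. monotone_operator T' \<longrightarrow> op_graph T \<subseteq> op_graph T' \<longrightarrow> op_graph T' = op_graph T)"

definition subdifferential :: "('a::real_inner \<Rightarrow> real) \<Rightarrow> 'a \<Rightarrow> 'a set"
  where "subdifferential f x = {g. \<forall>y. f y \<ge> f x + inner g (y - x)}"

definition normal_cone :: "'a::real_inner set \<Rightarrow> 'a \<Rightarrow> 'a set"
  where "normal_cone C x = (if x \<in> C then {n. \<forall>z\<in>C. inner n (z - x) \<le> 0} else {})"

text \<open>
  The library's \<open>closest_point\<close> is restricted to Heine-Borel spaces, which would exclude
  infinite dimension. The description below denotes the projection whenever \<open>S\<close> is nonempty,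
  closed and convex in a Hilbert space.
\<close>

definition metric_projection :: "'a::metric_space set \<Rightarrow> 'a \<Rightarrow> 'a"
  where "metric_projection S x = (THE p. p \<in> S \<and> (\<forall>y\<in>S. dist x p \<le> dist x y))"

definition feasible_set :: "('a \<Rightarrow> real) \<Rightarrow> 'a set"
  where "feasible_set c = {x. c x \<le> 0}"

definition solution_set :: "('a::real_inner \<Rightarrow> 'a set) \<Rightarrow> 'a set \<Rightarrow> 'a set"
  where "solution_set T C = {xs \<in> C. \<exists>u\<in>T xs. \<forall>x\<in>C. inner u (x - xs) \<ge> 0}"

definition minty_gap :: "('a::real_inner \<Rightarrow> 'a set) \<Rightarrow> 'a set \<Rightarrow> 'a \<Rightarrow> ereal"
  where "minty_gap T C x = Sup {ereal (inner w (x - z)) | z w. z \<in> C \<and> w \<in> T z}"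

definition minty_gap_plus :: "('a::real_inner \<Rightarrow> 'a set) \<Rightarrow> 'a set \<Rightarrow> 'a \<Rightarrow> ereal"
  where "minty_gap_plus T C x = max (minty_gap T C x) 0"

text \<open>The weight \<open>\<lambda>\<^sub>k\<close> of the Slater point \<open>s\<close> when the trial point \<open>z\<close> is pulled back to feasibility.\<close>

definition slater_weight :: "('a \<Rightarrow> real) \<Rightarrow> 'a \<Rightarrow> 'a \<Rightarrow> real"
  where "slater_weight c s z = (if c z \<le> 0 then 0 else c z / (c z - c s))"

text \<open>The sets \<open>C\<^sub>k\<close>, \<open>H\<^sub>k\<close> and \<open>W\<^sub>k\<close> of the algorithm, at the current iterate \<open>x\<close>.\<close>

definition constraint_cut :: "('a::real_inner \<Rightarrow> real) \<Rightarrow> 'a \<Rightarrow> 'a \<Rightarrow> 'a set"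
  where "constraint_cut c x g = (if c x > 0 then {z. c x + inner g (z - x) \<le> 0} else UNIV)"

definition operator_cut :: "'a::real_inner \<Rightarrow> 'a \<Rightarrow> 'a set"
  where "operator_cut y v = {z. inner v (z - y) \<le> 0}"

definition anchor_cut :: "'a::real_inner \<Rightarrow> 'a \<Rightarrow> 'a set"
  where "anchor_cut x0 x = {z. inner (z - x) (x0 - x) \<le> 0}"

text \<open>
  \<open>x\<close> is generated by the algorithm from \<open>x0\<close>, with chosen subgradients \<open>g\<close>
  (irrelevant at indices where \<open>c (x k) \<le> 0\<close>), trial points \<open>yt\<close>, corrected points \<open>y\<close>
  and operator values \<open>v\<close>. The oracle is represented by the sequences it returns along
  the run, so it may depend on the whole history.
\<close>

definition FSPA_run ::
    "('a::real_inner \<Rightarrow> 'a set) \<Rightarrow> ('a \<Rightarrow> real) \<Rightarrow> 'a \<Rightarrow> 'a \<Rightarrow>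
     (nat \<Rightarrow> 'a) \<Rightarrow> (nat \<Rightarrow> 'a) \<Rightarrow> (nat \<Rightarrow> 'a) \<Rightarrow> (nat \<Rightarrow> 'a) \<Rightarrow> (nat \<Rightarrow> 'a) \<Rightarrow> bool"
  where "FSPA_run T c s x0 x g yt y v \<longleftrightarrow>
    x 0 = x0 \<and>
    (\<forall>k. (c (x k) > 0 \<longrightarrow> g k \<in> subdifferential c (x k)) \<and>
         y k = (1 - slater_weight c s (yt k)) *\<^sub>R yt k + slater_weight c s (yt k) *\<^sub>R s \<and>
         v k \<in> T (y k) \<and>
         x (Suc k) = metric_projection
           (constraint_cut c (x k) (g k) \<inter> operator_cut (y k) (v k) \<inter> anchor_cut x0 (x k)) x0)"

end

theory Submission imports Defs
begin

text \<open>
  The cut defined by \<open>W\<^sub>k\<close> makes the anchored distances grow at least like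
  \<open>\<parallel>x\<^sup>k\<^sup>+\<^sup>1 - x\<^sup>0\<parallel>\<^sup>2 \<ge> \<parallel>x\<^sup>k - x\<^sup>0\<parallel>\<^sup>2 + \<parallel>x\<^sup>k\<^sup>+\<^sup>1 - x\<^sup>k\<parallel>\<^sup>2\<close>, while they stay below \<open>\<rho>\<close> because
  all cuts contain the solution set. Telescoping bounds the sum of the squared steps, so some step is
  short; since the next iterate satisfies the cuts \<open>C\<^sub>k\<close> and \<open>H\<^sub>k\<close>, a short step forces a small
  constraint violation and a small gap at the same index.
\<close>

section \<open>Metric projection in a Hilbert space\<close>

lemma parallelogram_midpoint:
  fixes a b x :: "'a::real_inner"
  shows "(norm (a - b))\<^sup>2 = 2 * (norm (x - a))\<^sup>2 + 2 * (norm (x - b))\<^sup>2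
           - 4 * (norm (x - midpoint a b))\<^sup>2"
proof -
  have "4 * (norm (x - midpoint a b))\<^sup>2 = (norm (2 *\<^sub>R (x - midpoint a b)))\<^sup>2"
    by (simp add: power_mult_distrib)
  also have "2 *\<^sub>R (x - midpoint a b) = (x - a) + (x - b)"
    by (simp add: midpoint_def algebra_simps scaleR_2)
  finally have *: "4 * (norm (x - midpoint a b))\<^sup>2 = (norm ((x - a) + (x - b)))\<^sup>2" .
  have "a - b = (x - b) - (x - a)" by simp
  then show ?thesis
    unfolding *
    by (simp only: power2_norm_eq_inner) (simp add: inner_simps inner_commute)
qed

text \<open>The sets \<open>A n\<close> of points whose squared distance to \<open>x\<close> exceeds
  the infimum by at most \<open>1 / Suc n\<close> are closed, nonempty and decreasing. The
  parallelogram identity makes their diameters shrink to zero, so completeness yields a common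
  point, which is a minimizer.\<close>

lemma hilbert_projection_exists:
  fixes S :: "'a::{real_inner, complete_space} set"
  assumes "closed S" "convex S" "S \<noteq> {}"
  obtains p where "p \<in> S" "\<And>q. q \<in> S \<Longrightarrow> dist x p \<le> dist x q"
proof -
  define D where "D = (INF q\<in>S. (norm (x - q))\<^sup>2)"
  have bdd: "bdd_below ((\<lambda>q. (norm (x - q))\<^sup>2) ` S)"
    by (intro bdd_belowI[of _ 0]) auto
  have D_le: "D \<le> (norm (x - q))\<^sup>2" if "q \<in> S" for q
    unfolding D_def using bdd that by (rule cINF_lower)
  define A where "A n = {q \<in> S. (norm (x - q))\<^sup>2 \<le> D + 1 / real (Suc n)}" for n
  have "\<exists>p. \<forall>n. p \<in> A n"
  proof (rule decreasing_closed_nest)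
    fix n
    show "closed (A n)"
      unfolding A_def by (intro closed_Collect_conj assms continuous_intros closed_Collect_le)
        (use assms(1) in simp)
    have "D < D + 1 / real (Suc n)" by simp
    then obtain q where "q \<in> S" "(norm (x - q))\<^sup>2 < D + 1 / real (Suc n)"
      unfolding D_def using cINF_less_iff[OF assms(3) bdd] by blast
    then show "A n \<noteq> {}" unfolding A_def by force
  next
    fix m n :: nat assume "m \<le> n"
    then have "1 / real (Suc n) \<le> 1 / real (Suc m)" by (simp add: frac_le)
    then show "A n \<subseteq> A m" unfolding A_def by auto
  next
    fix e :: real assume "e > 0"
    \<comment> \<open>For \<open>a\<close> and \<open>b\<close> in \<open>A n\<close> the midpoint
      lies in \<open>S\<close>, so its squared distance is at least \<open>D\<close>. The
      parallelogram identity then gives \<open>2 * (D + t) + 2 * (D + t) - 4 * D = 4 * t\<close> as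
      a bound for the squared distance of \<open>a\<close> and \<open>b\<close>, with slack
      \<open>t = 1 / Suc n\<close>; hence the threshold \<open>e\<^sup>2 / 4\<close>.\<close>
    then obtain n where n: "1 / real (Suc n) < e\<^sup>2 / 4"
      using nat_approx_posE[of "e\<^sup>2 / 4"] by (metis divide_pos_pos zero_less_numeral zero_less_power)
    have "dist a b < e" if "a \<in> A n" "b \<in> A n" for a b
    proof -
      have "midpoint a b \<in> S"
        using that assms(2) unfolding A_def midpoint_def
        by (simp add: convex_def scaleR_right_distrib)
      with that n have "(norm (a - b))\<^sup>2 < e\<^sup>2"
        unfolding parallelogram_midpoint[of a b x] A_def using D_le[of "midpoint a b"] by auto
      then show ?thesis using \<open>e > 0\<close> by (simp add: dist_norm power2_less_imp_less)
    qed
    then show "\<exists>n. \<forall>a \<in> A n. \<forall>b \<in> A n. dist a b < e" by blast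
  qed blast
  then obtain p where p: "\<And>n. p \<in> A n" by blast
  have "(norm (x - p))\<^sup>2 \<le> D"
  proof (rule field_le_epsilon)
    fix e :: real assume "e > 0"
    then obtain n where "1 / real (Suc n) < e" by (rule nat_approx_posE)
    then show "(norm (x - p))\<^sup>2 \<le> D + e" using p[of n] unfolding A_def by auto
  qed
  then have "dist x p \<le> dist x q" if "q \<in> S" for q
    using D_le[OF that] unfolding dist_norm by (meson norm_ge_zero order_trans power2_le_imp_le)
  with p[of 0] that show thesis unfolding A_def by blast
qed

text \<open>The definite description needs uniqueness as well: the midpoint of two nearest points is
  no closer than they are, and the parallelogram identity then forces them to coincide.\<close>

lemma metric_projection_works:
  fixes S :: "'a::{real_inner, complete_space} set"
  assumes "closed S" "convex S" "S \<noteq> {}"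
  shows "metric_projection S x \<in> S" "\<And>q. q \<in> S \<Longrightarrow> dist x (metric_projection S x) \<le> dist x q"
proof -
  obtain p where p: "p \<in> S" "\<And>q. q \<in> S \<Longrightarrow> dist x p \<le> dist x q"
    using hilbert_projection_exists[OF assms] by blast
  have "q = p" if q: "q \<in> S" "\<forall>r\<in>S. dist x q \<le> dist x r" for q
  proof -
    have "midpoint p q \<in> S"
      using p q assms(2) unfolding midpoint_def by (simp add: convex_def scaleR_right_distrib)
    then have "(norm (x - p))\<^sup>2 \<le> (norm (x - midpoint p q))\<^sup>2"
      and "(norm (x - q))\<^sup>2 \<le> (norm (x - midpoint p q))\<^sup>2"
      using p q by (simp_all add: dist_norm power_mono)
    then have "(norm (p - q))\<^sup>2 \<le> 0" unfolding parallelogram_midpoint[of p q x] by linarith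
    then show ?thesis by simp
  qed
  with p have "\<exists>!p. p \<in> S \<and> (\<forall>q\<in>S. dist x p \<le> dist x q)" by blast
  from theI'[OF this] show "metric_projection S x \<in> S"
    "\<And>q. q \<in> S \<Longrightarrow> dist x (metric_projection S x) \<le> dist x q"
    unfolding metric_projection_def by auto
qed

text \<open>If the angle were acute, a short move from the projection towards \<open>z\<close> would
  stay in \<open>S\<close> by convexity and come closer to \<open>x\<close>.\<close>

lemma metric_projection_variational:
  fixes S :: "'a::{real_inner, complete_space} set"
  assumes "closed S" "convex S" "z \<in> S"
  shows "inner (z - metric_projection S x) (x - metric_projection S x) \<le> 0"
proof -
  define p where "p = metric_projection S x"
  have p: "p \<in> S" "\<And>q. q \<in> S \<Longrightarrow> dist x p \<le> dist x q"
    unfolding p_def using metric_projection_works[OF assms(1,2)] assms(3) by blast+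
  have "\<not> inner (x - p) (z - p) > 0"
  proof
    assume "inner (x - p) (z - p) > 0"
    then obtain u where u: "u > 0" "u \<le> 1" "dist (p + u *\<^sub>R (z - p)) x < dist p x"
      using closer_point_lemma by blast
    have "p + u *\<^sub>R (z - p) = (1 - u) *\<^sub>R p + u *\<^sub>R z" by (simp add: algebra_simps)
    also have "\<dots> \<in> S" using assms p u by (simp add: convexD_alt)
    finally show False using p(2) u(3) by (metis dist_commute not_le)
  qed
  then show ?thesis unfolding p_def by (simp add: inner_commute)
qed

section \<open>Closedness and convexity of the solution set\<close>

text \<open>By maximality, being a zero amounts to the inequalities
  \<open>inner w z \<le> inner w y\<close> over the whole graph. Each is linear in \<open>z\<close>,
  so the zeros form an intersection of closed convex sets.\<close>

lemma closed_convex_zeros_maximal_monotone: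
  fixes A :: "'a::real_inner \<Rightarrow> 'a set"
  assumes "maximal_monotone A"
  shows "closed {z. 0 \<in> A z}" "convex {z. 0 \<in> A z}"
proof -
  have mono: "monotone_operator A"
    and maxi: "\<And>B. monotone_operator B \<Longrightarrow> op_graph A \<subseteq> op_graph B \<Longrightarrow> op_graph B = op_graph A"
    using assms unfolding maximal_monotone_def by auto
  have "0 \<in> A z" if z: "\<And>y w. w \<in> A y \<Longrightarrow> inner w z \<le> inner w y" for z
  proof -
    \<comment> \<open>The inequalities assumed for \<open>z\<close> say exactly that the pair
      \<open>(z, 0)\<close> is monotonically related to the graph of \<open>A\<close>. Adding it
      keeps monotonicity, so by maximality it was already there.\<close>
    define B where "B y = (if y = z then insert 0 (A z) else A y)" for y
    have "monotone_operator B"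
      using mono z unfolding monotone_operator_def op_graph_def B_def
      by (auto simp: inner_simps split: if_splits)
    moreover have "op_graph A \<subseteq> op_graph B" unfolding op_graph_def B_def by auto
    ultimately have "op_graph B = op_graph A" by (rule maxi)
    moreover have "(z, 0) \<in> op_graph B" unfolding op_graph_def B_def by simp
    ultimately show ?thesis unfolding op_graph_def by simp
  qed
  moreover have "inner w z \<le> inner w y" if "0 \<in> A z" "w \<in> A y" for z y w
    using mono that unfolding monotone_operator_def op_graph_def by (force simp: inner_simps)
  ultimately have "0 \<in> A z \<longleftrightarrow> (\<forall>y. \<forall>w\<in>A y. inner w z \<le> inner w y)" for z by metis
  then have "{z. 0 \<in> A z} = (\<Inter>y. \<Inter>w\<in>A y. {z. inner w z \<le> inner w y})" by auto
  then show "closed {z. 0 \<in> A z}" "convex {z. 0 \<in> A z}"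
    by (auto intro!: closed_INT convex_INT closed_halfspace_le convex_halfspace_le)
qed

text \<open>The variational inequality at \<open>z\<close> with \<open>u \<in> T z\<close> means
  that \<open>- u\<close> is normal to \<open>C\<close> at \<open>z\<close>. This form lets
  maximality of the sum apply to the solutions.\<close>

lemma solution_set_eq_zeros:
  "solution_set T C = {z. 0 \<in> T z + normal_cone C z}"
proof -
  have "0 \<in> T z + normal_cone C z \<longleftrightarrow> (\<exists>u\<in>T z. - u \<in> normal_cone C z)" for z
    by (auto simp: set_plus_def eq_commute[of 0] add_eq_0_iff)
  then show ?thesis unfolding solution_set_def normal_cone_def by auto
qed

section \<open>Feasibility of the corrected points and geometry of the cuts\<close>

text \<open>For an infeasible \<open>z\<close> the weight \<open>l\<close> is the root of
  \<open>(1 - l) * c z + l * c s = 0\<close>, and convexity bounds \<open>c\<close> at the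
  combination by this value.\<close>

lemma slater_point_feasible:
  assumes "convex_on UNIV c" "c s < 0"
  shows "c ((1 - slater_weight c s z) *\<^sub>R z + slater_weight c s z *\<^sub>R s) \<le> 0"
proof (cases "c z \<le> 0")
  case False
  define l where "l = c z / (c z - c s)"
  have l: "0 \<le> l" "l \<le> 1" using False assms(2) unfolding l_def by (auto simp: field_simps)
  have "c ((1 - l) *\<^sub>R z + l *\<^sub>R s) \<le> (1 - l) * c z + l * c s"
    using convex_onD[OF assms(1)] l by simp
  also have "\<dots> = 0" using False assms(2) unfolding l_def by (simp add: field_simps)
  finally show ?thesis using False unfolding slater_weight_def l_def by simp
qed (simp add: slater_weight_def)

lemma solution_in_constraint_cut:
  assumes "c z \<le> 0" "c x > 0 \<longrightarrow> g \<in> subdifferential c x"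
  shows "z \<in> constraint_cut c x g"
proof (cases "c x > 0")
  case True
  with assms(2) have "c x + inner g (z - x) \<le> c z" unfolding subdifferential_def by simp
  with assms(1) show ?thesis unfolding constraint_cut_def by simp
qed (simp add: constraint_cut_def)

text \<open>Monotonicity transfers the inequality from the value \<open>u\<close> at the solution to
  the value \<open>v\<close> at \<open>y\<close>. The solution may be tested against
  \<open>y\<close> because \<open>y\<close> is feasible.\<close>

lemma solution_in_operator_cut:
  assumes "monotone_operator T" "z \<in> solution_set T C" "y \<in> C" "v \<in> T y"
  shows "z \<in> operator_cut y v"
proof -
  obtain u where "u \<in> T z" "inner u (y - z) \<ge> 0"
    using assms unfolding solution_set_def by auto
  moreover have "inner (v - u) (y - z) \<ge> 0"
    using assms \<open>u \<in> T z\<close> unfolding monotone_operator_def op_graph_def by auto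
  ultimately show ?thesis unfolding operator_cut_def by (simp add: inner_simps)
qed

lemma closed_convex_cuts:
  fixes x :: "'a::real_inner"
  shows "closed (constraint_cut c x g \<inter> operator_cut y v \<inter> anchor_cut x0 x)"
    and "convex (constraint_cut c x g \<inter> operator_cut y v \<inter> anchor_cut x0 x)"
proof -
  have half: "closed {z. a + inner w (z - q) \<le> 0}" "convex {z. a + inner w (z - q) \<le> 0}"
    for a :: real and w q :: 'a
  proof -
    have "{z. a + inner w (z - q) \<le> 0} = {z. inner w z \<le> inner w q - a}"
      by (auto simp: inner_simps)
    then show "closed {z. a + inner w (z - q) \<le> 0}" "convex {z. a + inner w (z - q) \<le> 0}"
      by (simp_all add: closed_halfspace_le convex_halfspace_le)
  qed
  have "operator_cut y v = {z. 0 + inner v (z - y) \<le> 0}"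
    "anchor_cut x0 x = {z. 0 + inner (x0 - x) (z - x) \<le> 0}"
    unfolding operator_cut_def anchor_cut_def by (simp_all add: inner_commute)
  then have "closed (operator_cut y v)" "convex (operator_cut y v)"
    "closed (anchor_cut x0 x)" "convex (anchor_cut x0 x)"
    by (simp_all only: half)
  moreover have "closed (constraint_cut c x g)" "convex (constraint_cut c x g)"
    unfolding constraint_cut_def by (simp_all add: half)
  ultimately show "closed (constraint_cut c x g \<inter> operator_cut y v \<inter> anchor_cut x0 x)"
    "convex (constraint_cut c x g \<inter> operator_cut y v \<inter> anchor_cut x0 x)"
    by (simp_all add: closed_Int convex_Int)
qed

text \<open>Expanding the square about \<open>x\<close> leaves a cross term whose sign is the
  defining inequality of the cut.\<close>

lemma anchor_cut_pythagoras:
  assumes "z \<in> anchor_cut x0 x"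
  shows "(norm (z - x))\<^sup>2 \<le> (norm (z - x0))\<^sup>2 - (norm (x - x0))\<^sup>2"
proof -
  have "z - x0 = (z - x) - (x0 - x)" by simp
  then have "(norm (z - x0))\<^sup>2
      = (norm (z - x))\<^sup>2 - 2 * inner (z - x) (x0 - x) + (norm (x - x0))\<^sup>2"
    by (simp only: power2_norm_eq_inner) (simp add: inner_simps inner_commute)
  with assms show ?thesis unfolding anchor_cut_def by simp
qed

section \<open>Averaging, and well-definedness of the iteration\<close>

lemma exists_le_sqrt_average:
  fixes d :: "nat \<Rightarrow> real"
  assumes "m < N" "(\<Sum>i=m..<N. (d i)\<^sup>2) \<le> R"
  obtains i where "i \<in> {m..<N}" "d i \<le> sqrt (R / real (N - m))"
proof -
  have "\<exists>i\<in>{m..<N}. (d i)\<^sup>2 \<le> R / real (N - m)"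
  proof (rule ccontr)
    assume "\<not> ?thesis"
    then have "(\<Sum>i=m..<N. R / real (N - m)) < (\<Sum>i=m..<N. (d i)\<^sup>2)"
      using assms(1) by (intro sum_strict_mono) (simp_all add: not_le del: of_nat_diff)
    with assms show False by simp
  qed
  then show thesis using that real_le_rsqrt by blast
qed

text \<open>A fixed solution \<open>z\<close> stays in every intersection of cuts. Hence each
  intersection is nonempty, its projection exists, and no iterate is farther from \<open>x0\<close>
  than \<open>z\<close> is.\<close>

lemma fspa_iterates:
  fixes T :: "'a::{real_inner, complete_space} \<Rightarrow> 'a set"
  assumes run: "FSPA_run T c s x0 x g yt y v"
    and "convex_on UNIV c" "c s < 0" "monotone_operator T"
    and z: "z \<in> solution_set T (feasible_set c)"
  shows "norm (x k - x0) \<le> norm (x0 - z)"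
    and "x (Suc k) \<in> constraint_cut c (x k) (g k) \<inter> operator_cut (y k) (v k) \<inter> anchor_cut x0 (x k)"
proof -
  let ?S = "\<lambda>k. constraint_cut c (x k) (g k) \<inter> operator_cut (y k) (v k) \<inter> anchor_cut x0 (x k)"
  have x_0: "x 0 = x0" and x_Suc: "\<And>k. x (Suc k) = metric_projection (?S k) x0"
    using run unfolding FSPA_run_def by auto
  have "y k \<in> feasible_set c" for k
    using run slater_point_feasible[OF assms(2,3)] unfolding FSPA_run_def feasible_set_def by auto
  moreover have "v k \<in> T (y k)" for k using run unfolding FSPA_run_def by blast
  ultimately have "z \<in> operator_cut (y k) (v k)" for k
    using solution_in_operator_cut[OF assms(4) z] by blast
  moreover have "z \<in> constraint_cut c (x k) (g k)" for k
    using run z unfolding FSPA_run_def feasible_set_def solution_set_def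
    by (blast intro: solution_in_constraint_cut)
  ultimately have cuts: "z \<in> constraint_cut c (x k) (g k) \<inter> operator_cut (y k) (v k)" for k
    by blast
  have z_S: "z \<in> ?S k" for k
  proof (induction k)
    case 0
    \<comment> \<open>At the start the anchor equals the iterate, so the anchor cut is the whole
      space.\<close>
    show ?case using cuts[of 0] by (simp add: x_0 anchor_cut_def)
  next
    case (Suc k)
    \<comment> \<open>The variational inequality for the projection of \<open>x0\<close> onto the
      current intersection, tested at \<open>z\<close>, is precisely membership in the next anchor
      cut.\<close>
    have "z \<in> anchor_cut x0 (x (Suc k))"
      using metric_projection_variational[OF closed_convex_cuts Suc, of x0]
      unfolding x_Suc[symmetric] by (simp add: anchor_cut_def)
    with cuts[of "Suc k"] show ?case by blast
  qed
  show "x (Suc k) \<in> ?S k"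
    unfolding x_Suc using z_S[of k] by (intro metric_projection_works closed_convex_cuts) auto
  show "norm (x k - x0) \<le> norm (x0 - z)"
  proof (cases k)
    case (Suc j)
    have "dist x0 (x (Suc j)) \<le> dist x0 z"
      unfolding x_Suc using z_S[of j] by (intro metric_projection_works closed_convex_cuts) auto
    with Suc show ?thesis by (simp add: dist_norm norm_minus_commute)
  qed (simp add: x_0)
qed

section \<open>Convergence rates\<close>

theorem lemma4p4:
  fixes T :: "'a::{real_inner, complete_space} \<Rightarrow> 'a set"
    and c :: "'a \<Rightarrow> real"
    and C Sol :: "'a set"
    and s x0 xbar :: 'a
    and x g yt y v :: "nat \<Rightarrow> 'a"
    and \<sigma> \<rho> M\<^sub>c M\<^sub>T :: real
    and \<epsilon> :: "nat \<Rightarrow> real"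
  assumes C_def: "C = feasible_set c"
    and Sol_def: "Sol = solution_set T C"
    and A1_convex: "convex_on UNIV c"
    and A1_cont: "continuous_on UNIV c"
    and A1_nonempty: "C \<noteq> {}"
    and A1_bound: "\<And>B. bounded B \<Longrightarrow>
          \<exists>M>0. \<forall>z\<in>B. c z > 0 \<longrightarrow> (\<forall>h\<in>subdifferential c z. norm h \<le> M)"
    and A1_subdiff: "\<And>z. c z > 0 \<Longrightarrow> subdifferential c z \<noteq> {}"
    and A2: "c s < 0"
    and A3_T: "maximal_monotone T"
    and A3_dom: "C \<subseteq> op_dom T"
    and A3_sol: "Sol \<noteq> {}"
    and A3_sum: "maximal_monotone (\<lambda>z. T z + normal_cone C z)"
    and A4_sigma: "0 < \<sigma>" "\<sigma> \<le> 1"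
    and A4_eps: "\<And>k. \<epsilon> k \<ge> 0" "\<epsilon> \<longlonglongrightarrow> 0"
    and A4_oracle: "bounded (range x) \<Longrightarrow>
          bounded (range y) \<and> bounded (range v) \<and>
          (\<forall>k. ereal (max (inner (v k) (x k - y k)) 0)
                 \<ge> ereal \<sigma> * minty_gap_plus T C (x k) - ereal (\<epsilon> k))"
    and run: "FSPA_run T c s x0 x g yt y v"
    and xbar_def: "xbar = metric_projection Sol x0"
    and rho_def: "\<rho> = norm (x0 - xbar)"
    and Mc_pos: "M\<^sub>c > 0"
    and Mc_bound: "\<And>k h. c (x k) > 0 \<Longrightarrow> h \<in> subdifferential c (x k) \<Longrightarrow> norm h \<le> M\<^sub>c"
    and MT_def: "M\<^sub>T = (SUP k. norm (v k))"
  shows "bdd_above (range (\<lambda>k. norm (v k))) \<and>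
    (\<forall>N\<ge>1.
        (MIN i\<in>{0..<N}. norm (x (i + 1) - x i)) \<le> \<rho> / sqrt (real N) \<and>
        (MIN i\<in>{0..<N}. max (c (x i)) 0) \<le> M\<^sub>c * \<rho> / sqrt (real N) \<and>
        (MIN i\<in>{0..<N}. minty_gap_plus T C (x i))
          \<le> ereal (M\<^sub>T * \<rho> / (\<sigma> * sqrt (real N)) + 1 / \<sigma> * (MAX i\<in>{0..<N}. \<epsilon> i)) \<and>
        ((\<forall>i. \<epsilon> i = 0) \<longrightarrow>
          (MIN i\<in>{0..<N}. minty_gap_plus T C (x i)) \<le> ereal (M\<^sub>T * \<rho> / (\<sigma> * sqrt (real N))))) \<and>
    (\<forall>m N. m < N \<longrightarrow>
        (MIN i\<in>{m..<N}. minty_gap_plus T C (x i))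
          \<le> ereal (M\<^sub>T / \<sigma> * sqrt ((\<rho>\<^sup>2 - (norm (x m - x0))\<^sup>2) / real (N - m))
                     + 1 / \<sigma> * (MAX i\<in>{m..<N}. \<epsilon> i)))"
proof -
  have x_0: "x 0 = x0" using run unfolding FSPA_run_def by simp
  have mono: "monotone_operator T" using A3_T unfolding maximal_monotone_def by simp
  have "closed Sol" "convex Sol"
    using closed_convex_zeros_maximal_monotone[OF A3_sum]
    unfolding Sol_def solution_set_eq_zeros by auto
  then have "xbar \<in> Sol" unfolding xbar_def using A3_sol by (rule metric_projection_works)
  then have "xbar \<in> solution_set T (feasible_set c)" unfolding Sol_def C_def .
  \<comment> \<open>Choosing \<open>xbar\<close> as the solution kept in all cuts makes the uniform
    bound equal to \<open>\<rho>\<close>.\<close>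
  note it = fspa_iterates[OF run A1_convex A2 mono this]
  have x_le: "norm (x k - x0) \<le> \<rho>" for k using it(1) unfolding rho_def .
  define d where "d i = norm (x (Suc i) - x i)" for i
  have d_nonneg: "0 \<le> d i" for i unfolding d_def by simp
  have "bounded (range x)"
    using x_le by (intro bounded_subset[OF bounded_cball[of x0 \<rho>]])
      (auto simp: dist_norm norm_minus_commute)
  note gap_bound = A4_oracle[OF this]
  from gap_bound have bdd: "bdd_above (range (\<lambda>k. norm (v k)))"
    by (metis bounded_norm_comp bounded_imp_bdd_above)
  have v_le: "norm (v k) \<le> M\<^sub>T" for k unfolding MT_def using bdd by (rule cSUP_upper[OF UNIV_I])
  then have MT_nonneg: "0 \<le> M\<^sub>T" using norm_ge_zero order_trans by blast
  \<comment> \<open>The start index \<open>m\<close> is kept free: the subtracted anchored distance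
    at \<open>x m\<close> is what sharpens the bound for later windows.\<close>
  have sum_d: "(\<Sum>i=m..<N. (d i)\<^sup>2) \<le> \<rho>\<^sup>2 - (norm (x m - x0))\<^sup>2" if "m < N" for m N
  proof -
    have "(\<Sum>i=m..<N. (d i)\<^sup>2)
        \<le> (\<Sum>i=m..<N. (norm (x (Suc i) - x0))\<^sup>2 - (norm (x i - x0))\<^sup>2)"
      unfolding d_def using it(2) by (intro sum_mono anchor_cut_pythagoras) auto
    also have "\<dots> = (norm (x N - x0))\<^sup>2 - (norm (x m - x0))\<^sup>2"
      using that by (intro sum_Suc_diff') simp
    also have "\<dots> \<le> \<rho>\<^sup>2 - (norm (x m - x0))\<^sup>2" using x_le[of N] by (simp add: power_mono)
    finally show ?thesis .
  qed
  have c_le: "max (c (x i)) 0 \<le> M\<^sub>c * d i" for i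
  proof (cases "c (x i) > 0")
    case True
    have "c (x i) \<le> inner (g i) (x i - x (Suc i))"
      using it(2)[of i] True unfolding constraint_cut_def by (simp add: inner_simps)
    also have "\<dots> \<le> norm (g i) * d i"
      unfolding d_def by (subst norm_minus_commute) (rule norm_cauchy_schwarz)
    also have "\<dots> \<le> M\<^sub>c * d i"
      using run True Mc_bound d_nonneg unfolding FSPA_run_def by (intro mult_right_mono) auto
    finally show ?thesis using True by simp
  qed (use Mc_pos d_nonneg[of i] in simp)
  have gap_le: "minty_gap_plus T C (x i) \<le> ereal (M\<^sub>T / \<sigma> * d i + 1 / \<sigma> * \<epsilon> i)" for i
  proof -
    \<comment> \<open>The next iterate lies in the half-space through \<open>y i\<close> with normal
      \<open>v i\<close>, so it may replace \<open>y i\<close>; the difference becomes a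
      step.\<close>
    have "inner (v i) (x i - y i) \<le> inner (v i) (x i - x (Suc i))"
      using it(2)[of i] unfolding operator_cut_def by (simp add: inner_simps)
    also have "\<dots> \<le> norm (v i) * d i"
      unfolding d_def by (subst norm_minus_commute) (rule norm_cauchy_schwarz)
    also have "\<dots> \<le> M\<^sub>T * d i" using v_le d_nonneg by (intro mult_right_mono) auto
    finally have "max (inner (v i) (x i - y i)) 0 \<le> M\<^sub>T * d i" using MT_nonneg d_nonneg by simp
    with gap_bound have "ereal \<sigma> * minty_gap_plus T C (x i) - ereal (\<epsilon> i) \<le> ereal (M\<^sub>T * d i)"
      by (meson ereal_less_eq(3) order_trans)
    \<comment> \<open>The gap is extended real: the value \<open>\<infinity>\<close> would
      contradict the finite upper bound since \<open>\<sigma> > 0\<close>, and in the real case one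
      divides by \<open>\<sigma>\<close>.\<close>
    then show ?thesis
      using A4_sigma by (cases "minty_gap_plus T C (x i)") (auto simp: field_simps)
  qed
  have gap_min: "(MIN i\<in>{m..<N}. minty_gap_plus T C (x i))
      \<le> ereal (M\<^sub>T / \<sigma> * sqrt ((\<rho>\<^sup>2 - (norm (x m - x0))\<^sup>2) / real (N - m))
                + 1 / \<sigma> * (MAX i\<in>{m..<N}. \<epsilon> i))" if mN: "m < N" for m N
  proof -
    obtain i where i: "i \<in> {m..<N}" "d i \<le> sqrt ((\<rho>\<^sup>2 - (norm (x m - x0))\<^sup>2) / real (N - m))"
      using exists_le_sqrt_average[OF mN sum_d[OF mN]] .
    have "(MIN i\<in>{m..<N}. minty_gap_plus T C (x i)) \<le> minty_gap_plus T C (x i)"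
      using i(1) by (intro Min_le) auto
    also have "\<dots> \<le> ereal (M\<^sub>T / \<sigma> * d i + 1 / \<sigma> * \<epsilon> i)" by (rule gap_le)
    also have "\<dots> \<le> ereal (M\<^sub>T / \<sigma> * sqrt ((\<rho>\<^sup>2 - (norm (x m - x0))\<^sup>2) / real (N - m))
                + 1 / \<sigma> * (MAX i\<in>{m..<N}. \<epsilon> i))"
      using i MT_nonneg A4_sigma
      by (subst ereal_less_eq) (intro add_mono mult_left_mono Max_ge, auto)
    finally show ?thesis .
  qed
  have rho_nonneg: "0 \<le> \<rho>" unfolding rho_def by simp
  \<comment> \<open>For \<open>m = 0\<close> the anchored distance vanishes, so the windowed bound
    reduces to the basic rate.\<close>
  have sqrt_0: "sqrt ((\<rho>\<^sup>2 - (norm (x 0 - x0))\<^sup>2) / real (N - 0)) = \<rho> / sqrt (real N)" for N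
    using rho_nonneg by (simp add: x_0 real_sqrt_divide)
  have gap_0: "(MIN i\<in>{0..<N}. minty_gap_plus T C (x i))
      \<le> ereal (M\<^sub>T * \<rho> / (\<sigma> * sqrt (real N)) + 1 / \<sigma> * (MAX i\<in>{0..<N}. \<epsilon> i))" if "N \<ge> 1" for N
    using gap_min[of 0 N] that unfolding sqrt_0 by simp
  have "(MIN i\<in>{0..<N}. minty_gap_plus T C (x i)) \<le> ereal (M\<^sub>T * \<rho> / (\<sigma> * sqrt (real N)))"
    if "N \<ge> 1" "\<forall>i. \<epsilon> i = 0" for N
  proof -
    have "(MAX i\<in>{0..<N}. \<epsilon> i) = 0" using that by (simp add: image_constant_conv)
    with gap_0[OF that(1)] show ?thesis by simp
  qed
  moreover have "(MIN i\<in>{0..<N}. norm (x (i + 1) - x i)) \<le> \<rho> / sqrt (real N) \<and>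
      (MIN i\<in>{0..<N}. max (c (x i)) 0) \<le> M\<^sub>c * \<rho> / sqrt (real N)" if "N \<ge> 1" for N
  proof -
    have "0 < N" using that by simp
    then obtain i where i: "i \<in> {0..<N}" "d i \<le> \<rho> / sqrt (real N)"
      \<comment> \<open>The same index \<open>i\<close> serves both minima, as the violation at
        \<open>x i\<close> is bounded by a multiple of \<open>d i\<close>.\<close>
      using exists_le_sqrt_average[OF _ sum_d, of 0 N] unfolding sqrt_0 by blast
    have "(MIN i\<in>{0..<N}. norm (x (i + 1) - x i)) \<le> d i"
      unfolding d_def using i(1) by (intro Min_le) auto
    moreover have "(MIN i\<in>{0..<N}. max (c (x i)) 0) \<le> max (c (x i)) 0"
      using i(1) by (intro Min_le) auto
    moreover have "M\<^sub>c * d i \<le> M\<^sub>c * \<rho> / sqrt (real N)"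
      using mult_left_mono[OF i(2), of "M\<^sub>c"] Mc_pos by simp
    ultimately show ?thesis using i(2) c_le[of i] by linarith
  qed
  ultimately show ?thesis using bdd gap_0 gap_min by blast
qed

end
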